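(* Let $p$ be an odd prime, $B_k$ the Bernoulli numbers (with $B_1=-\tfrac12$), $\mathcal{B}_k=B_k/k$ for $k\ge1$, $w_p=\frac{(p-1)!+1}{p}$ the Wilson quotient, $q_p(2)=\frac{2^{p-1}-1}{p}$ the Fermat quotient, and $H_n=\sum_{j=1}^n\frac1j$. Then, modulo $p$: $$\sum_{k=1}^{p-2}\mathcal{B}_k\equiv\frac{pB_{p-1}+1}{p}-1\equiv w_p,$$ $$\sum_{k=1}^{p-2}\frac{\mathcal{B}_k}{2^k}\equiv q_p(2)+w_p,$$ $$\sum_{k=1}^{p-2}\frac{\mathcal{B}_k}{2^k}\equiv-\frac12H_{\frac{p-1}{2}}+\frac{pB_{p-1}+1}{p}-1,$$ $$\sum_{\substack{1\le k\le p-2\\ k\text{ even}}}\frac{B_k}{k\,2^k}\equiv\frac34+\sum_{\substack{1\le k\le p-2\\ k\text{ even}}}\frac{B_k-1}{k}.$$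
   Context: Congruences are taken in $\mathbb{Z}_p$; $\frac{pB_{p-1}+1}{p}\in\mathbb{Z}_p$. *)

theory Defs
  imports
    "HOL-Computational_Algebra.Primes"
    "HOL-Computational_Algebra.Formal_Power_Series"
begin

text \<open>
  Bernoulli numbers by the usual recursion
  \<open>(n + 1) B\<^sub>n = - (\<Sum>k<n. (n + 1 choose k) B\<^sub>k)\<close>, which gives \<open>B\<^sub>1 = -1/2\<close>.
\<close>

fun bernoulli :: "nat \<Rightarrow> rat" where
  "bernoulli n =
     (if n = 0 then 1
      else - (\<Sum>k<n. of_nat (Suc n choose k) * bernoulli k) / of_nat (Suc n))"

declare bernoulli.simps [simp del]

lemma bernoulli_0: "bernoulli 0 = 1"
  by (simp add: bernoulli.simps)

lemma bernoulli_1: "bernoulli 1 = - 1 / 2"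
  by (simp add: bernoulli.simps)

lemma bernoulli_2: "bernoulli 2 = 1 / 6"
  by (simp add: bernoulli.simps numeral_2_eq_2)

lemma sum_choose_bernoulli:
  "(\<Sum>k<n. of_nat (n choose k) * bernoulli k) = (if n = 1 then 1 else 0)"
proof (cases n)
  case (Suc m)
  then show ?thesis
    by (cases "m = 0") (simp_all add: bernoulli.simps[of m] bernoulli_0)
qed simp

text \<open>The exponential generating function is \<open>t / (exp t - 1)\<close>.\<close>

lemma fps_bernoulli:
  "Abs_fps (\<lambda>n. bernoulli n / fact n) * (fps_exp 1 - 1) = fps_X"
proof (rule fps_ext)
  fix n
  let ?F = "Abs_fps (\<lambda>n. bernoulli n / fact n)"
  have "fps_nth (?F * (fps_exp 1 - 1)) n =
      (\<Sum>k\<le>n. bernoulli k / fact k * (if k = n then 0 else 1 / fact (n - k)))"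
    unfolding fps_mult_nth atMost_atLeast0
    by (rule sum.cong) auto
  also have "\<dots> = (\<Sum>k<n. bernoulli k / fact k * (1 / fact (n - k)))"
    by (rule sum.mono_neutral_cong_right) auto
  also have "\<dots> = (\<Sum>k<n. of_nat (n choose k) * bernoulli k) / fact n"
    unfolding sum_divide_distrib
    by (rule sum.cong) (auto simp: binomial_fact)
  also have "\<dots> = fps_nth fps_X n"
    by (simp add: sum_choose_bernoulli)
  finally show "fps_nth (?F * (fps_exp 1 - 1)) n = fps_nth fps_X n" .
qed

definition divided_bernoulli :: "nat \<Rightarrow> rat" where
  "divided_bernoulli k = bernoulli k / of_nat k"

definition wilson_quotient :: "nat \<Rightarrow> rat" where
  "wilson_quotient p = (fact (p - 1) + 1) / of_nat p"

definition fermat_quotient :: "nat \<Rightarrow> nat \<Rightarrow> rat" where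
  "fermat_quotient p a = (of_nat a ^ (p - 1) - 1) / of_nat p"

definition harmonic_number :: "nat \<Rightarrow> rat" where
  "harmonic_number n = (\<Sum>j=1..n. 1 / of_nat j)"

text \<open>
  For prime \<open>p\<close>, \<open>Zp_rat p\<close> is the set of rational numbers lying in the ring of \<open>p\<close>-adic
  integers. A congruence modulo \<open>p\<close> requires both sides to lie in this ring.
\<close>

definition Zp_rat :: "nat \<Rightarrow> rat set" where
  "Zp_rat p = {x. \<exists>a b :: int. \<not> int p dvd b \<and> x = of_int a / of_int b}"

definition Zp_cong :: "rat \<Rightarrow> rat \<Rightarrow> nat \<Rightarrow> bool"
    (\<open>(\<open>notation=\<open>mixfix Zp_cong\<close>\<close>[_ \<equiv> _] '(mod \<int>\<^sub>p _'))\<close>) where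
  "[x \<equiv> y] (mod \<int>\<^sub>p p) \<longleftrightarrow>
     x \<in> Zp_rat p \<and> y \<in> Zp_rat p \<and> (\<exists>z\<in>Zp_rat p. x - y = of_nat p * z)"

end

theory Submission
  imports Defs "HOL-Number_Theory.Residues"
begin

text \<open>
  In Faulhaber's formula for the sum of \<open>j ^ (p - 1)\<close> over \<open>j < n\<close>, the identity
  \<open>(p choose k) = (p / k) * (p - 1 choose k - 1)\<close> and the congruence
  \<open>(p - 1 choose k - 1) \<equiv> (- 1) ^ (k - 1)\<close> make the divided Bernoulli numbers appear:
  the case \<open>n = 1\<close> yields the first sum, the case \<open>n = 2\<close> the sum with weights \<open>2 ^ (- k)\<close>, and
  the case \<open>n = p\<close> shows that \<open>(p B\<^bsub>p-1\<^esub> + 1) / p - 1\<close> is congruent to the sum of the Fermat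
  quotients of \<open>1, \<dots>, p - 1\<close>. The signs are harmless because \<open>B\<^sub>k = 0\<close> for odd \<open>k > 1\<close>.
  As Fermat quotients are logarithmic, that sum is the Fermat quotient of \<open>(p - 1)!\<close>, which is the
  Wilson quotient. Finally \<open>2 q\<^sub>p(2) \<equiv> - H\<^bsub>(p-1)/2\<^esub>\<close> follows from expanding \<open>(1 + 1) ^ p\<close>.
\<close>

subsection \<open>Bernoulli numbers\<close>

text \<open>The generating function F(t) = t / (exp t - 1) satisfies F(-t) = F(t) exp t = F(t) + t.
  Comparing coefficients of t^n for odd n other than 1 gives -F_n = F_n.\<close>

lemma bernoulli_odd_eq_0:
  assumes "odd n" "n \<noteq> 1"
  shows "bernoulli n = 0"
proof -
  define F where "F = Abs_fps (\<lambda>n. bernoulli n / fact n)"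
  define G where "G = F oo (- fps_X)"
  define E where "E = fps_exp (1::rat)"
  have F: "F * (E - 1) = fps_X"
    unfolding F_def E_def by (rule fps_bernoulli)
  have nz: "E - 1 \<noteq> 0"
    using F by auto
  have "(F * (E - 1)) oo (- fps_X) = G * ((E oo (- fps_X)) - 1)"
    by (simp add: G_def fps_compose_mult_distrib fps_compose_sub_distrib)
  moreover have "E oo (- fps_X) = fps_exp (- 1)"
    by (simp add: E_def fps_exp_compose_linear[of 1 "-1", simplified] flip: fps_const_neg)
  ultimately have G: "G * (fps_exp (- 1) - 1) = - fps_X"
    by (simp add: F)
  have inv: "fps_exp (- 1) * E = 1"
    by (simp add: E_def flip: fps_exp_add_mult)
  \<comment> \<open>Multiplying by \<open>E\<close> turns \<open>1 - fps_exp (- 1)\<close> into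
    \<open>E - 1\<close>, a nonzero factor that can then be cancelled from both sides.\<close>
  have "G * (E - 1) = - (G * (fps_exp (- 1) - 1)) * E"
    using inv by (simp add: algebra_simps)
  also have "\<dots> = (F * E) * (E - 1)"
    by (simp add: G flip: F)
  finally have "G = F * E"
    using nz by simp
  also have "\<dots> = F + fps_X"
    using F by (simp add: algebra_simps)
  finally have "fps_nth G n = fps_nth (F + fps_X) n"
    by simp
  moreover have "fps_nth G n = (- 1) ^ n * fps_nth F n"
    by (simp add: G_def fps_compose_uminus')
  ultimately show ?thesis
    using assms by (simp add: F_def)
qed

text \<open>In the induction on \<open>n\<close> the right side has to grow by (m + 1) n^m.
  Expanding the growth in powers of n, the coefficient of n^i contains the Bernoulli recursion sum
  of length m + 1 - i, which vanishes unless i = m.\<close>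

lemma faulhaber:
  "of_nat (Suc m) * (\<Sum>j<n. of_nat j ^ m) =
     (\<Sum>k\<le>m. of_nat (Suc m choose k) * bernoulli k * of_nat n ^ (Suc m - k))"
proof (induction n)
  case (Suc n)
  let ?c = "\<lambda>a b. of_nat (a choose b) :: rat"
  have binomial_diff: "of_nat (Suc n) ^ r - of_nat n ^ r = (\<Sum>i<r. ?c r i * of_nat n ^ i)" for r
    using binomial_ring[of "of_nat n :: rat" 1 r]
    by (simp add: lessThan_Suc_atMost[symmetric] add.commute)
  \<comment> \<open>Both products count pairs of disjoint subsets of sizes \<open>k\<close> and
    \<open>i\<close>. The second form isolates the sum over \<open>k\<close> once the order of
    summation is swapped.\<close>
  have trinomial: "?c (Suc m) k * ?c (Suc m - k) i = ?c (Suc m) i * ?c (Suc m - i) k"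
    if "i + k \<le> Suc m" for i k
  proof -
    have "(Suc m choose k) * (Suc m - k choose i) = (Suc m choose i) * (Suc m - i choose k)"
      using that choose_mult[of k "i + k" "Suc m"] choose_mult[of i "i + k" "Suc m"]
      by (simp add: binomial_symmetric[of k "i + k"])
    then show ?thesis
      by (metis of_nat_mult)
  qed
  have "(\<Sum>k\<le>m. ?c (Suc m) k * bernoulli k * of_nat (Suc n) ^ (Suc m - k)) -
        (\<Sum>k\<le>m. ?c (Suc m) k * bernoulli k * of_nat n ^ (Suc m - k)) =
        (\<Sum>k<Suc m. \<Sum>i<Suc m - k.
           ?c (Suc m) k * ?c (Suc m - k) i * (bernoulli k * of_nat n ^ i))"
    unfolding sum_subtractf[symmetric] right_diff_distrib[symmetric] binomial_diff
    by (simp add: sum_distrib_left mult_ac lessThan_Suc_atMost)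
  also have "\<dots> = (\<Sum>k<Suc m. \<Sum>i<Suc m - k.
           ?c (Suc m) i * of_nat n ^ i * (?c (Suc m - i) k * bernoulli k))"
    by (intro sum.cong refl) (simp add: trinomial mult_ac)
  also have "\<dots> = (\<Sum>i<Suc m. \<Sum>k<Suc m - i.
           ?c (Suc m) i * of_nat n ^ i * (?c (Suc m - i) k * bernoulli k))"
    unfolding sum.Sigma[OF finite_lessThan ballI[OF finite_lessThan]]
    by (rule sum.reindex_bij_witness[of _ "\<lambda>(a, b). (b, a)" "\<lambda>(a, b). (b, a)"]) auto
  also have "\<dots> = (\<Sum>i<Suc m. ?c (Suc m) i * of_nat n ^ i * (if Suc m - i = 1 then 1 else 0))"
    by (simp only: sum_choose_bernoulli flip: sum_distrib_left)
  also have "\<dots> = (\<Sum>i<Suc m. if i = m then ?c (Suc m) i * of_nat n ^ i else 0)"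
    by (intro sum.cong) auto
  also have "\<dots> = of_nat (Suc m) * of_nat n ^ m"
    by (simp add: sum.delta')
  finally show ?case
    using Suc.IH by (simp add: algebra_simps del: of_nat_Suc)
qed (simp add: power_0_left Suc_diff_le)

subsection \<open>Harmonic numbers\<close>

lemma harmonic_number_Suc: "harmonic_number (Suc n) = harmonic_number n + 1 / of_nat (Suc n)"
  by (simp add: harmonic_number_def)

text \<open>The odd upper bound is chosen to match the range up to p - 2, with n = (p - 3) /
  2.\<close>

lemma sum_inverse_even:
  "(\<Sum>k | k \<in> {1..2 * n + 1} \<and> even k. 1 / of_nat k) = harmonic_number n / 2"
proof -
  have "(\<Sum>k | k \<in> {1..2 * n + 1} \<and> even k. 1 / of_nat k :: rat) = (\<Sum>j=1..n. 1 / of_nat (2 * j))"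
    by (rule sum.reindex_bij_witness[of _ "\<lambda>j. 2 * j" "\<lambda>k. k div 2"]) auto
  then show ?thesis
    by (simp add: harmonic_number_def sum_divide_distrib mult.commute)
qed

text \<open>Each even index contributes -1/(2j) = 1/(2j) - 1/j.\<close>

lemma alternating_harmonic:
  "(\<Sum>k=1..2*n. (- 1) ^ (k - 1) / of_nat k) = harmonic_number (2 * n) - harmonic_number n"
proof (induction n)
  case (Suc n)
  have "1 / of_nat (Suc (Suc (2 * n))) = (1 / of_nat (Suc n) :: rat) / 2"
    by (simp add: field_simps)
  then show ?case
    using Suc.IH by (simp add: harmonic_number_Suc del: of_nat_Suc)
qed simp

subsection \<open>Congruences in \<open>\<int>\<^sub>p\<close>\<close>

context
  fixes p :: nat
  assumes p: "prime p"
begin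

lemma Zp_of_int [simp]: "of_int a \<in> Zp_rat p"
proof -
  have "\<not> int p dvd 1 \<and> of_int a = (of_int a / of_int 1 :: rat)"
    using p by auto
  then show ?thesis
    unfolding Zp_rat_def by blast
qed

lemma Zp_of_nat [simp]: "of_nat a \<in> Zp_rat p"
  using Zp_of_int[of "int a"] by simp

lemma Zp_0 [simp]: "0 \<in> Zp_rat p" and Zp_1 [simp]: "1 \<in> Zp_rat p"
  using Zp_of_int[of 0] Zp_of_int[of 1] by simp_all

lemma Zp_add [simp]:
  assumes "x \<in> Zp_rat p" "y \<in> Zp_rat p"
  shows "x + y \<in> Zp_rat p"
proof -
  obtain a b c d :: int where "\<not> int p dvd b" "\<not> int p dvd d"
    and "x = of_int a / of_int b" "y = of_int c / of_int d"
    using assms unfolding Zp_rat_def by blast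
  moreover from this have "b \<noteq> 0" "d \<noteq> 0"
    by auto
  ultimately have "\<not> int p dvd b * d" "x + y = of_int (a * d + c * b) / of_int (b * d)"
    using p by (auto simp: prime_dvd_mult_iff field_simps)
  then show ?thesis
    unfolding Zp_rat_def by blast
qed

lemma Zp_mult [simp]:
  assumes "x \<in> Zp_rat p" "y \<in> Zp_rat p"
  shows "x * y \<in> Zp_rat p"
proof -
  obtain a b c d :: int where "\<not> int p dvd b" "\<not> int p dvd d"
    and "x = of_int a / of_int b" "y = of_int c / of_int d"
    using assms unfolding Zp_rat_def by blast
  then have "\<not> int p dvd b * d" "x * y = of_int (a * c) / of_int (b * d)"
    using p by (auto simp: prime_dvd_mult_iff)
  then show ?thesis
    unfolding Zp_rat_def by blast
qed

lemma Zp_uminus [simp]: "x \<in> Zp_rat p \<Longrightarrow> - x \<in> Zp_rat p"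
  using Zp_mult[OF Zp_of_int[of "- 1"], of x] by simp

lemma Zp_diff [simp]: "x \<in> Zp_rat p \<Longrightarrow> y \<in> Zp_rat p \<Longrightarrow> x - y \<in> Zp_rat p"
  using Zp_add[of x "- y"] by simp

lemma Zp_power [simp]: "x \<in> Zp_rat p \<Longrightarrow> x ^ n \<in> Zp_rat p"
  by (induction n) simp_all

lemma Zp_sum [simp]: "(\<And>i. i \<in> A \<Longrightarrow> f i \<in> Zp_rat p) \<Longrightarrow> sum f A \<in> Zp_rat p"
  by (induction A rule: infinite_finite_induct) simp_all

lemma Zp_divide_of_nat:
  assumes "x \<in> Zp_rat p" "\<not> p dvd k"
  shows "x / of_nat k \<in> Zp_rat p"
proof -
  have "\<not> int p dvd int k \<and> 1 / of_nat k = (of_int 1 / of_int (int k) :: rat)"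
    using assms(2) by simp
  then have "1 / of_nat k \<in> Zp_rat p"
    unfolding Zp_rat_def by blast
  from Zp_mult[OF assms(1) this] show ?thesis
    by simp
qed

text \<open>Dividing by \<open>p\<close> eliminates the existential witness, so that congruences
  reduce to closure properties of the ring \<open>Zp_rat p\<close>.\<close>

lemma Zp_cong_iff:
  assumes "x \<in> Zp_rat p" "y \<in> Zp_rat p"
  shows "[x \<equiv> y] (mod \<int>\<^sub>p p) \<longleftrightarrow> (x - y) / of_nat p \<in> Zp_rat p"
proof -
  have "x - y = of_nat p * z \<longleftrightarrow> (x - y) / of_nat p = z" for z
    using p by (auto simp: field_simps)
  with assms show ?thesis
    unfolding Zp_cong_def by auto
qed

lemma Zp_congD: "[x \<equiv> y] (mod \<int>\<^sub>p p) \<Longrightarrow> (x - y) / of_nat p \<in> Zp_rat p"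
  using Zp_cong_iff unfolding Zp_cong_def by blast

lemma Zp_congI: "y \<in> Zp_rat p \<Longrightarrow> z \<in> Zp_rat p \<Longrightarrow> x = y + of_nat p * z \<Longrightarrow> [x \<equiv> y] (mod \<int>\<^sub>p p)"
  unfolding Zp_cong_def by auto

lemma Zp_cong_refl [simp]: "x \<in> Zp_rat p \<Longrightarrow> [x \<equiv> x] (mod \<int>\<^sub>p p)"
  by (simp add: Zp_cong_iff)

lemma Zp_cong_add:
  assumes "[x \<equiv> y] (mod \<int>\<^sub>p p)" "[x' \<equiv> y'] (mod \<int>\<^sub>p p)"
  shows "[x + x' \<equiv> y + y'] (mod \<int>\<^sub>p p)"
proof -
  have "(x - y) / of_nat p + (x' - y') / of_nat p \<in> Zp_rat p"
    using assms by (intro Zp_add Zp_congD)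
  moreover have "(x - y) / of_nat p + (x' - y') / of_nat p = (x + x' - (y + y')) / of_nat p"
    by (simp add: diff_divide_distrib add_divide_distrib)
  ultimately show ?thesis
    using assms by (subst Zp_cong_iff) (auto simp: Zp_cong_def)
qed

lemma Zp_cong_mult:
  assumes "[x \<equiv> y] (mod \<int>\<^sub>p p)" "[x' \<equiv> y'] (mod \<int>\<^sub>p p)"
  shows "[x * x' \<equiv> y * y'] (mod \<int>\<^sub>p p)"
proof -
  have Zp: "x \<in> Zp_rat p" "y \<in> Zp_rat p" "x' \<in> Zp_rat p" "y' \<in> Zp_rat p"
    using assms unfolding Zp_cong_def by auto
  have "(x - y) / of_nat p * x' + y * ((x' - y') / of_nat p) \<in> Zp_rat p"
    using assms Zp by (intro Zp_add Zp_mult Zp_congD)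
  moreover have "(x - y) / of_nat p * x' + y * ((x' - y') / of_nat p) = (x * x' - y * y') / of_nat p"
    by (simp add: algebra_simps diff_divide_distrib)
  ultimately show ?thesis
    using Zp by (subst Zp_cong_iff) auto
qed

lemma Zp_cong_uminus: "[x \<equiv> y] (mod \<int>\<^sub>p p) \<Longrightarrow> [- x \<equiv> - y] (mod \<int>\<^sub>p p)"
  using Zp_cong_mult[of "- 1" "- 1" x y] by simp

lemma Zp_cong_diff:
  "[x \<equiv> y] (mod \<int>\<^sub>p p) \<Longrightarrow> [x' \<equiv> y'] (mod \<int>\<^sub>p p) \<Longrightarrow> [x - x' \<equiv> y - y'] (mod \<int>\<^sub>p p)"
  using Zp_cong_add[OF _ Zp_cong_uminus, of x y x' y'] by simp

lemma Zp_cong_sym: "[x \<equiv> y] (mod \<int>\<^sub>p p) \<Longrightarrow> [y \<equiv> x] (mod \<int>\<^sub>p p)"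
  \<comment> \<open>Subtract the given congruence from the reflexive one at
    \<open>x + y\<close>.\<close>
  using Zp_cong_diff[of "x + y" "x + y" x y] unfolding Zp_cong_def[of x y] by simp

lemma Zp_cong_trans [trans]:
  "[x \<equiv> y] (mod \<int>\<^sub>p p) \<Longrightarrow> [y \<equiv> z] (mod \<int>\<^sub>p p) \<Longrightarrow> [x \<equiv> z] (mod \<int>\<^sub>p p)"
  \<comment> \<open>Add the two congruences and cancel the middle term \<open>y\<close>.\<close>
  using Zp_cong_diff[OF Zp_cong_add[of x y y z] Zp_cong_refl[of y]]
  unfolding Zp_cong_def[of y z] by simp

lemma Zp_cong_sum:
  "(\<And>i. i \<in> A \<Longrightarrow> [f i \<equiv> g i] (mod \<int>\<^sub>p p)) \<Longrightarrow> [sum f A \<equiv> sum g A] (mod \<int>\<^sub>p p)"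
  by (induction A rule: infinite_finite_induct) (auto intro: Zp_cong_add)

(* cong is applied in prefix form: the token "(mod" of Zp_cong hides the notation of Cong. *)
lemma Zp_cong_of_int: "cong a b (int p) \<Longrightarrow> [of_int a \<equiv> of_int b] (mod \<int>\<^sub>p p)"
  unfolding cong_iff_dvd_diff
proof (elim dvdE)
  fix c
  assume "a - b = int p * c"
  then have "(of_int a :: rat) - of_int b = of_nat p * of_int c"
    by (metis of_int_diff of_int_mult of_int_of_nat_eq)
  then show "[of_int a \<equiv> of_int b] (mod \<int>\<^sub>p p)"
    by (intro Zp_congI[of _ "of_int c"]) auto
qed

subsection \<open>Fermat and Wilson quotients\<close>

lemma fermat_quotient_in_Zp:
  assumes "\<not> p dvd a"
  shows "fermat_quotient p a \<in> Zp_rat p"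
proof -
  have "cong (int a ^ (p - 1)) 1 (int p)"
    using fermat_theorem[OF p assms] by (metis cong_int_iff of_nat_1 of_nat_power)
  from Zp_congD[OF Zp_cong_of_int[OF this]] show ?thesis
    by (simp add: fermat_quotient_def)
qed

lemma power_eq_fermat_quotient: "of_nat a ^ (p - 1) = 1 + of_nat p * fermat_quotient p a"
  using p by (simp add: fermat_quotient_def)

text \<open>In the product of 1 + p q_p(a) and 1 + p q_p(b) the cross term carries p^2, so a factor
  p survives the division by p.\<close>

lemma fermat_quotient_mult:
  assumes "\<not> p dvd a" "\<not> p dvd b"
  shows "[fermat_quotient p (a * b) \<equiv> fermat_quotient p a + fermat_quotient p b] (mod \<int>\<^sub>p p)"
proof (rule Zp_congI)
  have "of_nat p * fermat_quotient p (a * b) =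
      of_nat p * (fermat_quotient p a + fermat_quotient p b +
        of_nat p * (fermat_quotient p a * fermat_quotient p b))"
    using power_eq_fermat_quotient[of "a * b"]
    unfolding of_nat_mult power_mult_distrib power_eq_fermat_quotient
    by (simp add: algebra_simps)
  then show "fermat_quotient p (a * b) = fermat_quotient p a + fermat_quotient p b +
      of_nat p * (fermat_quotient p a * fermat_quotient p b)"
    using p by simp
qed (use assms in \<open>auto simp: fermat_quotient_in_Zp\<close>)

lemma fermat_quotient_fact:
  "n < p \<Longrightarrow> [fermat_quotient p (fact n) \<equiv> (\<Sum>j=1..n. fermat_quotient p j)] (mod \<int>\<^sub>p p)"
proof (induction n)
  case 0
  show ?case
    by (simp add: fermat_quotient_def)
next
  case (Suc n)
  have Suc_n: "\<not> p dvd Suc n"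
    using Suc.prems dvd_imp_le[of p "Suc n"] by linarith
  moreover have "\<not> p dvd fact n"
    using Suc.prems prime_dvd_fact_iff[OF p] by simp
  ultimately have "[fermat_quotient p (fact n * Suc n) \<equiv>
      fermat_quotient p (fact n) + fermat_quotient p (Suc n)] (mod \<int>\<^sub>p p)"
    by (intro fermat_quotient_mult)
  also have "[fermat_quotient p (fact n) + fermat_quotient p (Suc n) \<equiv>
      (\<Sum>j=1..n. fermat_quotient p j) + fermat_quotient p (Suc n)] (mod \<int>\<^sub>p p)"
    using Suc.prems Suc_n by (intro Zp_cong_add Suc.IH Zp_cong_refl fermat_quotient_in_Zp) simp_all
  also have "fact n * Suc n = fact (Suc n)"
    by simp
  finally show ?case
    by (simp only: sum.cl_ivl_Suc) simp
qed

text \<open>This is the binomial expansion to first order in p. It is needed for z = -w_p, where (p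
  - 1)! is minus 1 + p z.\<close>

lemma power_one_plus_cong:
  assumes "z \<in> Zp_rat p"
  shows "[((1 + of_nat p * z) ^ n - 1) / of_nat p \<equiv> of_nat n * z] (mod \<int>\<^sub>p p)"
proof (induction n)
  case (Suc n)
  define y where "y = ((1 + of_nat p * z) ^ n - 1) / of_nat p"
  have y: "[y \<equiv> of_nat n * z] (mod \<int>\<^sub>p p)"
    unfolding y_def by (rule Suc)
  have "of_nat p \<noteq> (0 :: rat)"
    using p by auto
  moreover from this have "(1 + of_nat p * z) ^ n = 1 + of_nat p * y"
    by (simp add: y_def)
  then have "(1 + of_nat p * z) ^ Suc n - 1 = of_nat p * (y + z + of_nat p * (y * z))"
    by (simp add: algebra_simps)
  ultimately have "((1 + of_nat p * z) ^ Suc n - 1) / of_nat p = y + z + of_nat p * (y * z)"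
    by (simp only: nonzero_mult_div_cancel_left not_False_eq_True)
  also have "[\<dots> \<equiv> y + z] (mod \<int>\<^sub>p p)"
    using y assms by (intro Zp_congI[of _ "y * z"]) (auto simp: Zp_cong_def)
  also have "[y + z \<equiv> of_nat n * z + z] (mod \<int>\<^sub>p p)"
    using y assms by (intro Zp_cong_add) auto
  finally show ?case
    by (simp add: algebra_simps)
qed simp

lemma wilson_quotient_in_Zp: "wilson_quotient p \<in> Zp_rat p"
proof -
  have "cong (fact (p - 1)) (- 1) (int p)"
    by (rule wilson_theorem[OF p])
  from Zp_congD[OF Zp_cong_of_int[OF this]] show ?thesis
    by (simp add: wilson_quotient_def)
qed

text \<open>Since (p - 1)! = -(1 - p w_p) and the exponent p - 1 is even, the sign disappears. The
  first-order expansion then gives (p - 1)(-w_p), which is w_p modulo p.\<close>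

lemma fermat_quotient_fact_eq_wilson:
  assumes "odd p"
  shows "[fermat_quotient p (fact (p - 1)) \<equiv> wilson_quotient p] (mod \<int>\<^sub>p p)"
proof -
  have w: "- wilson_quotient p \<in> Zp_rat p"
    by (simp add: wilson_quotient_in_Zp)
  have "even (p - 1)"
    using assms by simp
  then have "(1 + of_nat p * (- wilson_quotient p)) ^ (p - 1) = fact (p - 1) ^ (p - 1)"
    using p by (simp add: wilson_quotient_def)
  then have "[fermat_quotient p (fact (p - 1)) \<equiv> of_nat (p - 1) * (- wilson_quotient p)] (mod \<int>\<^sub>p p)"
    using power_one_plus_cong[OF w, of "p - 1"] by (simp add: fermat_quotient_def)
  also have "[of_nat (p - 1) * (- wilson_quotient p) \<equiv> wilson_quotient p] (mod \<int>\<^sub>p p)"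
    using w prime_gt_0_nat[OF p]
    by (intro Zp_congI[of _ "- wilson_quotient p"])
       (auto simp: wilson_quotient_in_Zp of_nat_diff algebra_simps)
  finally show ?thesis .
qed

subsection \<open>Binomial coefficients and harmonic numbers modulo \<open>p\<close>\<close>

text \<open>By Pascal's rule neighbouring entries of row p - 1 add up to an entry of row p, which is
  divisible by p; hence each step flips the sign.\<close>

lemma binomial_pred_prime_cong:
  "k < p \<Longrightarrow> [of_nat (p - 1 choose k) \<equiv> (- 1) ^ k] (mod \<int>\<^sub>p p)"
proof (induction k)
  case (Suc k)
  have "p dvd (p choose Suc k)"
    using Suc.prems p by (intro dvd_choose_prime) auto
  then obtain c where c: "p choose Suc k = p * c" ..
  have "(p - 1 choose k) + (p - 1 choose Suc k) = p * c"
    using prime_gt_0_nat[OF p] c binomial_Suc_Suc[of "p - 1" k] by simp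
  then have "of_nat (p - 1 choose k) + of_nat (p - 1 choose Suc k) = (of_nat p * of_nat c :: rat)"
    by (simp flip: of_nat_add of_nat_mult)
  then have "(of_nat (p - 1 choose Suc k) :: rat) = - of_nat (p - 1 choose k) + of_nat p * of_nat c"
    by (simp add: algebra_simps)
  then have "[of_nat (p - 1 choose Suc k) \<equiv> - of_nat (p - 1 choose k)] (mod \<int>\<^sub>p p)"
    by (intro Zp_congI[of _ "of_nat c"]) auto
  also have "[- of_nat (p - 1 choose k) \<equiv> - ((- 1) ^ k)] (mod \<int>\<^sub>p p)"
    using Suc by (intro Zp_cong_uminus) auto
  finally show ?case
    by simp
qed simp

lemma binomial_prime_eq:
  assumes "k > 0"
  shows "(of_nat (p choose k) :: rat) = of_nat p * (of_nat (p - 1 choose (k - 1)) / of_nat k)"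
proof -
  have "k * (p choose k) = p * (p - 1 choose (k - 1))"
    using assms times_binomial_minus1_eq by blast
  then have "(of_nat k :: rat) * of_nat (p choose k) = of_nat p * of_nat (p - 1 choose (k - 1))"
    by (metis of_nat_mult)
  with assms show ?thesis
    by (simp add: field_simps)
qed

lemma not_prime_dvd_less: "0 < k \<Longrightarrow> k < p \<Longrightarrow> \<not> p dvd k"
  by (auto dest: dvd_imp_le)

lemma Zp_inverse_less: "0 < k \<Longrightarrow> k < p \<Longrightarrow> 1 / of_nat k \<in> Zp_rat p"
  by (intro Zp_divide_of_nat not_prime_dvd_less) auto

lemma harmonic_number_in_Zp: "n < p \<Longrightarrow> harmonic_number n \<in> Zp_rat p"
  unfolding harmonic_number_def by (intro Zp_sum Zp_inverse_less) auto

context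
  assumes odd_p: "odd p"
begin

lemma p_ge_3: "p \<ge> 3"
  using odd_p prime_ge_2_nat[OF p] by (cases "p = 2") auto

lemma Zp_half [simp]: "1 / 2 \<in> Zp_rat p"
  using Zp_inverse_less[of 2] p_ge_3 by simp

text \<open>Pair j with p - j: 1/j + 1/(p - j) = p / (j (p - j)). This counts the sum twice, and 2
  is invertible because p is odd.\<close>

lemma harmonic_number_pred_prime: "[harmonic_number (p - 1) \<equiv> 0] (mod \<int>\<^sub>p p)"
proof -
  let ?H = "harmonic_number (p - 1)"
  define z :: rat where "z = (\<Sum>j=1..p-1. 1 / of_nat j * (1 / of_nat (p - j)))"
  have "?H = (\<Sum>j=1..p-1. 1 / of_nat (p - j))"
    unfolding harmonic_number_def
    by (rule sum.reindex_bij_witness[of _ "\<lambda>j. p - j" "\<lambda>j. p - j"]) auto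
  then have "?H + ?H = (\<Sum>j=1..p-1. 1 / of_nat j + 1 / of_nat (p - j))"
    unfolding sum.distrib by (simp add: harmonic_number_def)
  also have "\<dots> = of_nat p * z"
    unfolding z_def sum_distrib_left
  proof (rule sum.cong)
    fix j
    assume "j \<in> {1..p-1}"
    then have "j + (p - j) = p" and nz: "(of_nat j :: rat) \<noteq> 0" "(of_nat (p - j) :: rat) \<noteq> 0"
      by (auto simp: of_nat_eq_0_iff simp del: of_nat_diff)
    then have "(of_nat p :: rat) = of_nat j + of_nat (p - j)"
      by (metis of_nat_add)
    moreover have "1 / a + 1 / b = (a + b) * (1 / a * (1 / b))" if "a \<noteq> 0" "b \<noteq> 0" for a b :: rat
      using that by (simp add: field_simps)
    note this[OF nz]
    ultimately show "1 / of_nat j + 1 / of_nat (p - j) = (of_nat p :: rat) * (1 / of_nat j * (1 / of_nat (p - j)))"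
      by metis
  qed simp
  finally have "?H = 0 + of_nat p * (1 / 2 * z)"
    by simp
  moreover have "z \<in> Zp_rat p"
    unfolding z_def by (intro Zp_sum Zp_mult Zp_inverse_less) auto
  ultimately show ?thesis
    by (intro Zp_congI[of _ "1 / 2 * z"] Zp_mult) auto
qed

text \<open>In 2^p the outer binomial coefficients give 2 and the inner ones give p T, so q_p(2) = T
  / 2. Modulo p, T is an alternating harmonic sum, that is H_(p-1) - H_((p-1)/2), and H_(p-1)
  vanishes.\<close>

lemma fermat_quotient_2_cong:
  "[fermat_quotient p 2 \<equiv> - (1 / 2) * harmonic_number ((p - 1) div 2)] (mod \<int>\<^sub>p p)"
proof -
  define T :: rat where "T = (\<Sum>k=1..p-1. of_nat (p - 1 choose (k - 1)) * (1 / of_nat k))"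
  have "(2::rat) ^ p = (\<Sum>k\<le>p. of_nat (p choose k))"
    using binomial_ring[of "1 :: rat" 1 p] by simp
  also have "{..p} = insert 0 (insert p {1..p-1})"
    using p_ge_3 by auto
  also have "(\<Sum>k\<in>\<dots>. of_nat (p choose k) :: rat) = 2 + (\<Sum>k=1..p-1. of_nat (p choose k))"
  proof -
    have "0 \<notin> insert p {1..p-1}" "p \<notin> {1..p-1}"
      using p_ge_3 by auto
    then show ?thesis
      by (simp only: sum.insert finite_insert finite_atLeastAtMost not_False_eq_True) simp
  qed
  also have "(\<Sum>k=1..p-1. of_nat (p choose k)) = of_nat p * T"
    unfolding T_def sum_distrib_left by (intro sum.cong) (auto simp: binomial_prime_eq)
  finally have "2 * 2 ^ (p - 1) = 2 + of_nat p * T"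
    using p_ge_3 by (simp flip: power_Suc)
  then have "fermat_quotient p 2 = 1 / 2 * T"
    using p by (simp add: fermat_quotient_def field_simps)
  moreover have "[T \<equiv> (\<Sum>k=1..p-1. (- 1) ^ (k - 1) * (1 / of_nat k))] (mod \<int>\<^sub>p p)"
    unfolding T_def
    by (intro Zp_cong_sum Zp_cong_mult binomial_pred_prime_cong Zp_cong_refl Zp_inverse_less) auto
  moreover have "(\<Sum>k=1..p-1. (- 1) ^ (k - 1) * (1 / of_nat k)) =
      harmonic_number (p - 1) - harmonic_number ((p - 1) div 2)"
    using alternating_harmonic[of "(p - 1) div 2"] odd_p by simp
  ultimately have "[fermat_quotient p 2 \<equiv>
      1 / 2 * (harmonic_number (p - 1) - harmonic_number ((p - 1) div 2))] (mod \<int>\<^sub>p p)"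
    by (simp only: Zp_cong_mult[OF Zp_cong_refl[OF Zp_half]])
  also have "[1 / 2 * (harmonic_number (p - 1) - harmonic_number ((p - 1) div 2)) \<equiv>
      1 / 2 * (0 - harmonic_number ((p - 1) div 2))] (mod \<int>\<^sub>p p)"
    using p_ge_3
    by (intro Zp_cong_mult Zp_cong_diff harmonic_number_pred_prime Zp_cong_refl
        harmonic_number_in_Zp Zp_half) auto
  finally show ?thesis
    by simp
qed

subsection \<open>Sums of divided Bernoulli numbers\<close>

text \<open>For k up to p - 2 the recursion divides only by numbers up to p - 1, which are prime to
  p.\<close>

lemma bernoulli_in_Zp: "k \<le> p - 2 \<Longrightarrow> bernoulli k \<in> Zp_rat p"
proof (induction k rule: less_induct)
  case (less k)
  have "(\<Sum>i<k. of_nat (Suc k choose i) * bernoulli i) \<in> Zp_rat p"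
    using less by (intro Zp_sum Zp_mult) auto
  moreover have "\<not> p dvd Suc k"
    using less.prems p_ge_3 by (intro not_prime_dvd_less) auto
  ultimately show ?case
    by (subst bernoulli.simps) (auto intro!: Zp_divide_of_nat Zp_uminus simp del: of_nat_Suc Zp_sum)
qed

lemma divided_bernoulli_in_Zp: "k \<in> {1..p-2} \<Longrightarrow> divided_bernoulli k \<in> Zp_rat p"
  unfolding divided_bernoulli_def
  by (intro Zp_divide_of_nat bernoulli_in_Zp not_prime_dvd_less) auto

lemma faulhaber_prime:
  "(\<Sum>j<n. of_nat j ^ (p - 1)) =
     of_nat n ^ p / of_nat p + bernoulli (p - 1) * of_nat n +
     (\<Sum>k=1..p-2. of_nat (p - 1 choose (k - 1)) * (divided_bernoulli k * of_nat n ^ (p - k)))"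
proof -
  let ?f = "\<lambda>k. of_nat (p choose k) * bernoulli k * of_nat n ^ (p - k)"
  have p': "Suc (p - 1) = p"
    using p_ge_3 by simp
  have "of_nat p * (\<Sum>j<n. of_nat j ^ (p - 1)) = (\<Sum>k\<le>p-1. ?f k)"
    using faulhaber[of "p - 1" n] unfolding p' .
  also have "{..p-1} = insert 0 (insert (p - 1) {1..p-2})"
    using p_ge_3 by auto
  also have "sum ?f \<dots> = ?f 0 + (?f (p - 1) + (\<Sum>k=1..p-2. ?f k))"
  proof -
    have "0 \<notin> insert (p - 1) {1..p-2}" "p - 1 \<notin> {1..p-2}"
      using p_ge_3 by auto
    then show ?thesis
      by (simp only: sum.insert finite_insert finite_atLeastAtMost not_False_eq_True)
  qed
  also have "?f 0 = of_nat n ^ p"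
    by (simp add: bernoulli_0)
  also have "?f (p - 1) = of_nat p * (bernoulli (p - 1) * of_nat n)"
    using p_ge_3 binomial_symmetric[of 1 p] by simp
  also have "(\<Sum>k=1..p-2. ?f k) = of_nat p *
     (\<Sum>k=1..p-2. of_nat (p - 1 choose (k - 1)) * (divided_bernoulli k * of_nat n ^ (p - k)))"
    unfolding sum_distrib_left
    by (intro sum.cong) (auto simp: binomial_prime_eq divided_bernoulli_def)
  finally show ?thesis
    using p by (simp add: field_simps)
qed

lemma sum_split_even:
  assumes "\<And>k. k \<in> {1..p-2} \<Longrightarrow> odd k \<Longrightarrow> k \<noteq> 1 \<Longrightarrow> f k = 0"
  shows "(\<Sum>k=1..p-2. f k) = f 1 + (\<Sum>k | k \<in> {1..p-2} \<and> even k. f k)"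
proof -
  have "(\<Sum>k=1..p-2. f k) = sum f (insert 1 {k \<in> {1..p-2}. even k})"
    using assms p_ge_3 by (intro sum.mono_neutral_right) auto
  then show ?thesis
    by simp
qed

text \<open>The sign (-1)^(k-1) is -1 at even k but +1 at k = 1, the only odd index with a nonzero
  term. Correcting for it adds twice the term at 1, and \<open>divided_bernoulli 1\<close> is -1/2,
  whence the summand \<open>- c 1\<close>.\<close>

lemma weighted_sum_cong:
  assumes c: "\<And>k. k \<in> {1..p-2} \<Longrightarrow> c k \<in> Zp_rat p"
  shows "[\<Sum>k=1..p-2. of_nat (p - 1 choose (k - 1)) * (divided_bernoulli k * c k)
      \<equiv> - (\<Sum>k=1..p-2. divided_bernoulli k * c k) - c 1] (mod \<int>\<^sub>p p)"
proof -
  let ?b = "\<lambda>k. divided_bernoulli k * c k"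
  have b0: "divided_bernoulli k = 0" if "odd k" "k \<noteq> 1" for k
    using that by (simp add: divided_bernoulli_def bernoulli_odd_eq_0)
  have "[\<Sum>k=1..p-2. of_nat (p - 1 choose (k - 1)) * ?b k
      \<equiv> (\<Sum>k=1..p-2. (- 1) ^ (k - 1) * ?b k)] (mod \<int>\<^sub>p p)"
    by (intro Zp_cong_sum Zp_cong_mult binomial_pred_prime_cong Zp_cong_refl Zp_mult c
        divided_bernoulli_in_Zp) auto
  also have "(\<Sum>k=1..p-2. (- 1) ^ (k - 1) * ?b k) =
      ?b 1 + (\<Sum>k | k \<in> {1..p-2} \<and> even k. (- 1) ^ (k - 1) * ?b k)"
    by (subst sum_split_even) (auto simp: b0)
  also have "(\<Sum>k | k \<in> {1..p-2} \<and> even k. (- 1) ^ (k - 1) * ?b k) =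
      - (\<Sum>k | k \<in> {1..p-2} \<and> even k. ?b k)"
    unfolding sum_negf[symmetric] by (intro sum.cong) auto
  also have "(\<Sum>k | k \<in> {1..p-2} \<and> even k. ?b k) = (\<Sum>k=1..p-2. ?b k) - ?b 1"
    by (subst sum_split_even) (auto simp: b0)
  also have "?b 1 + - ((\<Sum>k=1..p-2. ?b k) - ?b 1) = - (\<Sum>k=1..p-2. ?b k) - c 1"
    using bernoulli_1 by (simp add: divided_bernoulli_def)
  finally show ?thesis .
qed

lemma sum_divided_bernoulli_cong:
  "[\<Sum>k=1..p-2. divided_bernoulli k
      \<equiv> (of_nat p * bernoulli (p - 1) + 1) / of_nat p - 1] (mod \<int>\<^sub>p p)"
proof -
  let ?x = "(of_nat p * bernoulli (p - 1) + 1) / of_nat p - 1"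
  let ?C = "\<Sum>k=1..p-2. of_nat (p - 1 choose (k - 1)) * (divided_bernoulli k * 1)"
  \<comment> \<open>The only summand is 0^(p-1), with positive exponent.\<close>
  have power_sum: "(\<Sum>j<1. of_nat j ^ (p - 1)) = (0 :: rat)"
    using p_ge_3 by simp
  have "1 / of_nat p + bernoulli (p - 1) + ?C = 0"
    using faulhaber_prime[of 1] unfolding power_sum by simp
  moreover have "?x = 1 / of_nat p + bernoulli (p - 1) - 1"
    using p by (simp add: add_divide_distrib)
  ultimately have "?C = - ?x - 1"
    by linarith
  then have "[- ?x - 1 \<equiv> - (\<Sum>k=1..p-2. divided_bernoulli k * 1) - 1] (mod \<int>\<^sub>p p)"
    using weighted_sum_cong[of "\<lambda>_. 1"] by simp
  from Zp_cong_sym[OF Zp_cong_diff[OF Zp_cong_uminus[OF this] Zp_cong_refl[OF Zp_1]]]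
  show ?thesis
    by simp
qed

lemma bernoulli_cong_wilson:
  "[(of_nat p * bernoulli (p - 1) + 1) / of_nat p - 1 \<equiv> wilson_quotient p] (mod \<int>\<^sub>p p)"
proof -
  let ?x = "(of_nat p * bernoulli (p - 1) + 1) / of_nat p - 1"
  define Z where "Z = (\<Sum>k=1..p-2. of_nat (p - 1 choose (k - 1)) *
    (divided_bernoulli k * of_nat p ^ (p - 2 - k)))"
  have Z: "Z \<in> Zp_rat p"
    unfolding Z_def by (intro Zp_sum Zp_mult Zp_power Zp_of_nat divided_bernoulli_in_Zp)
  \<comment> \<open>All exponents p - k are at least 2, so p^2 can be pulled out; one factor p
    remains after the later division by p.\<close>
  have "(\<Sum>j<p. of_nat j ^ (p - 1)) = of_nat p ^ p / of_nat p + bernoulli (p - 1) * of_nat p +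
      of_nat p ^ 2 * Z"
    unfolding faulhaber_prime Z_def sum_distrib_left
  proof (intro arg_cong2[of _ _ _ _ "(+)"] refl sum.cong)
    fix k
    assume "k \<in> {1..p-2}"
    then have "p - k = 2 + (p - 2 - k)"
      by auto
    then have "(of_nat p :: rat) ^ (p - k) = of_nat p ^ 2 * of_nat p ^ (p - 2 - k)"
      by (metis power_add)
    then show "of_nat (p - 1 choose (k - 1)) * (divided_bernoulli k * of_nat p ^ (p - k)) =
        of_nat p ^ 2 * (of_nat (p - 1 choose (k - 1)) * (divided_bernoulli k * of_nat p ^ (p - 2 - k)))"
      by simp
  qed
  moreover have "of_nat p ^ p = (of_nat p :: rat) ^ 3 * of_nat p ^ (p - 3)"
    using p_ge_3 by (simp flip: power_add)
  moreover have "(\<Sum>j<p. of_nat j ^ (p - 1)) = (\<Sum>j=1..p-1. of_nat j ^ (p - 1) :: rat)"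
    using p_ge_3 by (intro sum.mono_neutral_cong_right) auto
  moreover have "\<dots> = of_nat p - 1 + of_nat p * (\<Sum>j=1..p-1. fermat_quotient p j)"
    unfolding power_eq_fermat_quotient sum.distrib sum_distrib_left
    using p_ge_3 by (simp add: of_nat_diff)
  ultimately have "(\<Sum>j=1..p-1. fermat_quotient p j) = ?x + of_nat p * (of_nat p ^ (p - 3) + Z)"
    using p by (simp add: field_simps power2_eq_square power3_eq_cube)
  \<comment> \<open>A congruence includes integrality of both sides, so the case n = 1 already shows
    that (p B_(p-1) + 1) / p is p-integral.\<close>
  moreover have "?x \<in> Zp_rat p"
    using sum_divided_bernoulli_cong by (simp add: Zp_cong_def)
  ultimately have "[\<Sum>j=1..p-1. fermat_quotient p j \<equiv> ?x] (mod \<int>\<^sub>p p)"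
    using Z by (intro Zp_congI[of _ "of_nat p ^ (p - 3) + Z"]) auto
  then have "[?x \<equiv> (\<Sum>j=1..p-1. fermat_quotient p j)] (mod \<int>\<^sub>p p)"
    by (rule Zp_cong_sym)
  also have "[\<Sum>j=1..p-1. fermat_quotient p j \<equiv> fermat_quotient p (fact (p - 1))] (mod \<int>\<^sub>p p)"
    using p_ge_3 by (intro Zp_cong_sym[OF fermat_quotient_fact]) auto
  also have "[fermat_quotient p (fact (p - 1)) \<equiv> wilson_quotient p] (mod \<int>\<^sub>p p)"
    by (rule fermat_quotient_fact_eq_wilson[OF odd_p])
  finally show ?thesis .
qed

lemma sum_divided_bernoulli_half_cong:
  "[\<Sum>k=1..p-2. divided_bernoulli k / 2 ^ k
      \<equiv> fermat_quotient p 2 + ((of_nat p * bernoulli (p - 1) + 1) / of_nat p - 1)] (mod \<int>\<^sub>p p)"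
proof -
  let ?x = "(of_nat p * bernoulli (p - 1) + 1) / of_nat p - 1" and ?q = "fermat_quotient p 2"
  let ?B = "\<lambda>k. of_nat (p - 1 choose (k - 1)) * (divided_bernoulli k * (1 / 2) ^ k)"
  let ?C = "\<Sum>k=1..p-2. ?B k"
  have q: "?q \<in> Zp_rat p"
    using p_ge_3 by (intro fermat_quotient_in_Zp not_prime_dvd_less) auto
  have C: "?C \<in> Zp_rat p"
    by (intro Zp_sum Zp_mult Zp_power Zp_of_nat divided_bernoulli_in_Zp Zp_half)
  have pow: "(2::rat) ^ (p - 1) = 1 + of_nat p * ?q"
    using power_eq_fermat_quotient[of 2] by simp
  have pow_p: "(2::rat) ^ p = 2 * (1 + of_nat p * ?q)"
    using p_ge_3 by (simp flip: pow power_Suc)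
  have "(\<Sum>k=1..p-2. of_nat (p - 1 choose (k - 1)) * (divided_bernoulli k * 2 ^ (p - k))) =
      2 ^ p * ?C"
    unfolding sum_distrib_left
    by (intro sum.cong refl) (auto simp: power_diff power_divide)
  moreover have "(\<Sum>j<2. of_nat j ^ (p - 1)) = (1 :: rat)"
    using p_ge_3 by (simp add: numeral_2_eq_2)
  ultimately have "1 = 2 ^ p / of_nat p + bernoulli (p - 1) * 2 + 2 ^ p * ?C"
    using faulhaber_prime[of 2] by simp
  \<comment> \<open>Solving for \<open>?C\<close> leaves it on the right as well, but only with the
    factor p. The constant 1/2 later cancels against the correction term \<open>c 1\<close> for the
    weights 2^(-k).\<close>
  then have C_eq: "?C = (- ?x - ?q - 1 / 2) + of_nat p * (- (?q * ?C))"
    unfolding pow_p using p by (simp add: field_simps)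
  have x: "?x \<in> Zp_rat p"
    using sum_divided_bernoulli_cong by (simp add: Zp_cong_def)
  have "[?C \<equiv> - ?x - ?q - 1 / 2] (mod \<int>\<^sub>p p)"
    by (rule Zp_congI[OF Zp_diff[OF Zp_diff[OF Zp_uminus[OF x] q] Zp_half]
          Zp_uminus[OF Zp_mult[OF q C]] C_eq])
  moreover have "[?C \<equiv> - (\<Sum>k=1..p-2. divided_bernoulli k * (1 / 2) ^ k) - (1 / 2) ^ 1] (mod \<int>\<^sub>p p)"
    by (intro weighted_sum_cong Zp_power Zp_half)
  ultimately have "[- (\<Sum>k=1..p-2. divided_bernoulli k * (1 / 2) ^ k) - (1 / 2) ^ 1
      \<equiv> - ?x - ?q - 1 / 2] (mod \<int>\<^sub>p p)"
    by (blast intro: Zp_cong_trans Zp_cong_sym)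
  from Zp_cong_diff[OF Zp_cong_uminus[OF this] Zp_cong_refl[OF Zp_half]]
  show ?thesis
    by (simp add: power_divide algebra_simps)
qed

lemma sum_even_bernoulli_half_cong:
  "[\<Sum>k | k \<in> {1..p-2} \<and> even k. bernoulli k / (of_nat k * 2 ^ k)
      \<equiv> 3 / 4 + (\<Sum>k | k \<in> {1..p-2} \<and> even k. (bernoulli k - 1) / of_nat k)] (mod \<int>\<^sub>p p)"
proof -
  let ?x = "(of_nat p * bernoulli (p - 1) + 1) / of_nat p - 1"
  let ?h = "(p - 1) div 2"
  let ?S = "\<Sum>k=1..p-2. divided_bernoulli k"
  let ?S2 = "\<Sum>k=1..p-2. divided_bernoulli k / 2 ^ k"
  have b0: "divided_bernoulli k = 0" if "odd k" "k \<noteq> 1" for k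
    using that by (simp add: divided_bernoulli_def bernoulli_odd_eq_0)
  have b1: "divided_bernoulli (Suc 0) = - 1 / 2"
    using bernoulli_1 by (simp add: divided_bernoulli_def)
  \<comment> \<open>The term at k = 1 is -1/4 here; in the unweighted sum it is -1/2.\<close>
  have "?S2 + 1 / 4 = (\<Sum>k | k \<in> {1..p-2} \<and> even k. divided_bernoulli k / 2 ^ k)"
    by (subst sum_split_even) (auto simp: b0 b1)
  then have lhs: "(\<Sum>k | k \<in> {1..p-2} \<and> even k. bernoulli k / (of_nat k * 2 ^ k)) = ?S2 + 1 / 4"
    by (simp add: divided_bernoulli_def)
  have "(\<Sum>k | k \<in> {1..p-2} \<and> even k. bernoulli k / of_nat k) = ?S + 1 / 2"
    by (subst sum_split_even) (auto simp: b0 b1 simp flip: divided_bernoulli_def)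
  moreover have "{1..p-2} = {1..2 * (?h - 1) + 1}"
    using odd_p p_ge_3 by (auto elim!: oddE)
  then have "(\<Sum>k | k \<in> {1..p-2} \<and> even k. 1 / of_nat k) = harmonic_number (?h - 1) / 2"
    by (simp only: sum_inverse_even)
  moreover have "harmonic_number ?h = harmonic_number (?h - 1) + 1 / of_nat ?h"
    using harmonic_number_Suc[of "?h - 1"] p_ge_3 by simp
  moreover have "(\<Sum>k | k \<in> {1..p-2} \<and> even k. (bernoulli k - 1) / of_nat k) =
      (\<Sum>k | k \<in> {1..p-2} \<and> even k. bernoulli k / of_nat k) -
      (\<Sum>k | k \<in> {1..p-2} \<and> even k. 1 / of_nat k)"
    by (simp add: diff_divide_distrib sum_subtractf)
  \<comment> \<open>The right side exhibits 1/h = 2/(p - 1) as -2 plus a multiple of p. Half of it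
    is subtracted from the even sum of 1/k, so the constants combine to 3/4 + 1/2 - 1 = 1/4.\<close>
  moreover have "1 / of_nat ?h = 2 * (of_nat p * (1 / of_nat (p - 1)) - 1 :: rat)"
    using odd_p p_ge_3 by (auto elim!: oddE simp: field_simps)
  ultimately have rhs: "3 / 4 + (\<Sum>k | k \<in> {1..p-2} \<and> even k. (bernoulli k - 1) / of_nat k) =
      ?S - 1 / 2 * harmonic_number ?h + 1 / 4 + of_nat p * (1 / of_nat (p - 1))"
    by (simp only: ring_distribs)
  have half: "1 / 4 \<in> Zp_rat p"
    using Zp_mult[OF Zp_half Zp_half] by simp
  note fermat_quotient_2_cong
  then have H: "[- (1 / 2) * harmonic_number ?h \<equiv> fermat_quotient p 2] (mod \<int>\<^sub>p p)"
    by (rule Zp_cong_sym)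
  have "[?S + - (1 / 2) * harmonic_number ?h \<equiv> ?x + fermat_quotient p 2] (mod \<int>\<^sub>p p)"
    by (intro Zp_cong_add sum_divided_bernoulli_cong H)
  moreover have "[?S2 \<equiv> ?x + fermat_quotient p 2] (mod \<int>\<^sub>p p)"
    using sum_divided_bernoulli_half_cong by (simp only: add.commute)
  ultimately have "[?S2 \<equiv> ?S + - (1 / 2) * harmonic_number ?h] (mod \<int>\<^sub>p p)"
    by (blast intro: Zp_cong_trans Zp_cong_sym)
  then have *: "[?S2 + 1 / 4 \<equiv> ?S + - (1 / 2) * harmonic_number ?h + 1 / 4] (mod \<int>\<^sub>p p)"
    by (intro Zp_cong_add Zp_cong_refl half)
  also have "[?S + - (1 / 2) * harmonic_number ?h + 1 / 4 \<equiv>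
      ?S - 1 / 2 * harmonic_number ?h + 1 / 4 + of_nat p * (1 / of_nat (p - 1))] (mod \<int>\<^sub>p p)"
    using * p_ge_3
    by (intro Zp_cong_sym[OF Zp_congI[of _ "1 / of_nat (p - 1)"]] Zp_inverse_less)
       (auto simp: Zp_cong_def)
  finally show ?thesis
    unfolding lhs rhs .
qed

end

end

theorem theorem6:
  fixes p :: nat
  assumes "prime p" and "odd p"
  shows
    "[\<Sum>k=1..p-2. divided_bernoulli k
        \<equiv> (of_nat p * bernoulli (p - 1) + 1) / of_nat p - 1] (mod \<int>\<^sub>p p) \<and>
     [(of_nat p * bernoulli (p - 1) + 1) / of_nat p - 1 \<equiv> wilson_quotient p] (mod \<int>\<^sub>p p) \<and>
     [\<Sum>k=1..p-2. divided_bernoulli k / 2 ^ k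
        \<equiv> fermat_quotient p 2 + wilson_quotient p] (mod \<int>\<^sub>p p) \<and>
     [\<Sum>k=1..p-2. divided_bernoulli k / 2 ^ k
        \<equiv> - (1 / 2) * harmonic_number ((p - 1) div 2)
          + (of_nat p * bernoulli (p - 1) + 1) / of_nat p - 1] (mod \<int>\<^sub>p p) \<and>
     [\<Sum>k | k \<in> {1..p-2} \<and> even k. bernoulli k / (of_nat k * 2 ^ k)
        \<equiv> 3 / 4 + (\<Sum>k | k \<in> {1..p-2} \<and> even k. (bernoulli k - 1) / of_nat k)] (mod \<int>\<^sub>p p)"
proof -
  let ?x = "(of_nat p * bernoulli (p - 1) + 1) / of_nat p - 1"
  note half_sum = sum_divided_bernoulli_half_cong[OF assms]
  have q: "fermat_quotient p 2 \<in> Zp_rat p" and x: "?x \<in> Zp_rat p"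
    using fermat_quotient_2_cong[OF assms] bernoulli_cong_wilson[OF assms]
    by (simp_all add: Zp_cong_def)
  \<comment> \<open>Both forms of the weighted sum come from \<open>half_sum\<close>: here the
    Bernoulli term is replaced by w_p, below q_p(2) is replaced by the harmonic number.\<close>
  have "[\<Sum>k=1..p-2. divided_bernoulli k / 2 ^ k
      \<equiv> fermat_quotient p 2 + wilson_quotient p] (mod \<int>\<^sub>p p)"
    using assms(1) q
    by (intro Zp_cong_trans[OF _ half_sum] Zp_cong_add bernoulli_cong_wilson assms Zp_cong_refl)
  moreover have "[\<Sum>k=1..p-2. divided_bernoulli k / 2 ^ k
      \<equiv> - (1 / 2) * harmonic_number ((p - 1) div 2) + ?x] (mod \<int>\<^sub>p p)"
    using assms(1) x
    by (intro Zp_cong_trans[OF _ half_sum] Zp_cong_add fermat_quotient_2_cong assms Zp_cong_refl)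
  ultimately show ?thesis
    using sum_divided_bernoulli_cong[OF assms] bernoulli_cong_wilson[OF assms]
      sum_even_bernoulli_half_cong[OF assms]
    by (simp only: add_diff_eq simp_thms)
qed

end
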